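(* Let $p>1$. The constant $2^{1-p}\left(\frac{p}{p-1}\right)^p$ in the inequality \[ \int_0^\infty |M(t)-A(t)|^p\,dt\leq 2^{1-p}\left(\frac{p}{p-1}\right)^p\int_0^\infty f(t)^p\,dt \qquad (f\ge 0,\ f\in L^p(0,\infty)) \] is best possible. That is, if $C\in\mathbb R$ is such that \[ \int_0^\infty |M(t)-A(t)|^p\,dt\leq C\int_0^\infty f(t)^p\,dt \] for every measurable $f:(0,\infty)\to[0,\infty)$ with $f\in L^p(0,\infty)$, where $A(t)=\frac1t\int_0^t f(s)\,ds$ and $M(t)$ is the lower median of $f$ on $(0,t)$, then \[ C\geq 2^{1-p}\left(\frac{p}{p-1}\right)^p. \]
   Context: Here $p$ is a real number and $\operatorname{meas}$ denotes Lebesgue measure on $(0,\infty)$. For a nonnegative measurable function $f$ on $(0,\infty)$ and $t>0$, the lower median of $f$ on $(0,t)$ is \[ M(t)=\inf\left\{a\in\mathbb R:\operatorname{meas}\{s\in(0,t):f(s)\leq a\}\geq \tfrac t2\right\}. \] Then $M(t)\ge 0$, and the function $t\mapsto M(t)$ is measurable, so the integrals above are well defined. *)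

theory Defs
  imports "HOL-Analysis.Analysis"
begin

text \<open>
  A function on the half-line is modelled as a total function on the reals of which
  only the values on \<open>{0<..}\<close> matter.
\<close>

definition nonneg_Lp :: "real \<Rightarrow> (real \<Rightarrow> real) set" where
  "nonneg_Lp p = {f. f \<in> borel_measurable (lebesgue_on {0<..}) \<and> (\<forall>x>0. 0 \<le> f x) \<and>
     integrable (lebesgue_on {0<..}) (\<lambda>x. \<bar>f x\<bar> powr p)}"

text \<open>
  For \<open>t > 0\<close> and \<open>f\<close> measurable and nonnegative on \<open>{0<..}\<close>, the set below is nonempty
  (as \<open>f\<close> is finite-valued) and bounded below by 0, so the infimum is the genuine one.
\<close>

definition lower_median :: "(real \<Rightarrow> real) \<Rightarrow> real \<Rightarrow> real" where
  "lower_median f t = Inf {a. t / 2 \<le> measure lebesgue {s \<in> {0<..<t}. f s \<le> a}}"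

text \<open>
  Elements of \<open>nonneg_Lp p\<close> with \<open>p \<ge> 1\<close> are integrable on \<open>{0<..<t}\<close>, so the Bochner
  integral does not take its default value here.
\<close>

definition average :: "(real \<Rightarrow> real) \<Rightarrow> real \<Rightarrow> real" where
  "average f t = (1 / t) * (\<integral>s. f s \<partial>lebesgue_on {0<..<t})"

end

theory Submission
  imports Defs "HOL-Real_Asymp.Real_Asymp"
begin

text \<open>
  Hardy's inequality has the constant \<open>(p / (p - 1)) powr p\<close>, and powers close to
  \<open>s powr (- 1 / p)\<close> show that it is sharp. The median can be kept from interfering by erasing such a
  power on half of the line: if every interval \<open>{0<..<t}\<close> carries zeros on at least half of its length,
  the lower median vanishes identically and only the average remains. When the erased parts are spread
  evenly, the erasure halves the averages asymptotically and halves the integral of the \<open>p\<close>-th power.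
  The ratio of the two sides is therefore Hardy's constant times \<open>(1 / 2) powr p / (1 / 2)\<close>, that is,
  times \<open>2 powr (1 - p)\<close>.

  The function \<open>halved_power \<alpha>\<close> keeps \<open>s powr - \<alpha>\<close> on the upper halves of the unit intervals
  \<open>{n..<n + 1}\<close> with \<open>n \<ge> 1\<close>. Translation by \<open>1 / 2\<close> exchanges upper and lower halves, so the
  comparison of a decreasing function with its translate (\<open>nn_integral_mono_translate\<close>) supplies all
  three facts required: the median is 0 (\<open>lower_median_eq_0\<close>), the integral of the \<open>p\<close>-th power is at
  most half of the full one (\<open>nn_integral_halved_power_le\<close>), and the average at \<open>t\<close> is at least half of
  that of the power over \<open>{3 / 2..<t}\<close> (\<open>average_halved_power_ge\<close>).

  The unit cells are not small compared with \<open>s\<close> when \<open>s\<close> is bounded, but this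
  does no harm: as \<open>\<alpha>\<close> decreases to \<open>1 / p\<close>, both integrals diverge at infinity, and the contribution of
  any bounded range becomes negligible. Accordingly \<open>constant_ge_at_exponent\<close> uses the averages only on
  \<open>{T..}\<close>, and the limits \<open>\<alpha> \<rightarrow> 1 / p\<close> and then \<open>T \<rightarrow> \<infinity>\<close> give the constant.
\<close>

section \<open>Alternating half-cells and translation\<close>

definition upper_halves :: "real set" where
  "upper_halves = {s. 1 / 2 \<le> frac s}"

text \<open>
  Starting at 1 rather than 0 keeps the function bounded and makes it \<open>p\<close>-integrable for every
  \<open>\<alpha> > 1 / p\<close>; the behaviour of the power at 0 would require the opposite inequality.
\<close>

definition halved_power :: "real \<Rightarrow> real \<Rightarrow> real" where
  "halved_power \<alpha> s = s powr - \<alpha> * indicator (upper_halves \<inter> {1..}) s"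

lemma upper_halves_borel [measurable]: "upper_halves \<in> sets borel"
  unfolding upper_halves_def frac_def by measurable

lemma upper_halves_shift: "s - 1 / 2 \<in> upper_halves \<longleftrightarrow> s \<notin> upper_halves"
proof -
  have "\<lfloor>s - 1 / 2\<rfloor> = (if 1 / 2 \<le> frac s then \<lfloor>s\<rfloor> else \<lfloor>s\<rfloor> - 1)"
    by (simp add: frac_def) linarith
  then show ?thesis
    using frac_lt_1[of s] frac_ge_0[of s] by (auto simp: upper_halves_def frac_def)
qed

lemma upper_halves_ge:
  assumes "s \<in> upper_halves" "of_int n \<le> s"
  shows "of_int n + 1 / 2 \<le> s"
  using assms unfolding upper_halves_def frac_def by (auto simp flip: le_floor_iff)

lemma halved_power_nonneg: "0 \<le> halved_power \<alpha> s"
  unfolding halved_power_def by simp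

lemma halved_power_borel [measurable]: "halved_power \<alpha> \<in> borel_measurable borel"
  unfolding halved_power_def by measurable

text \<open>
  Translation invariance of Lebesgue measure, in the form in which mass on upper halves is traded for mass
  on lower halves. The comparison is required only almost everywhere because a translated open
  interval can miss an endpoint.
\<close>

lemma nn_integral_mono_translate:
  fixes h k :: "real \<Rightarrow> ennreal"
  assumes [measurable]: "k \<in> borel_measurable borel"
    and le: "AE s in lborel. h s \<le> k (s - c)"
  shows "(\<integral>\<^sup>+ s. h s \<partial>lborel) \<le> (\<integral>\<^sup>+ s. k s \<partial>lborel)"
proof -
  have "(\<integral>\<^sup>+ s. h s \<partial>lborel) \<le> (\<integral>\<^sup>+ s. k (- c + 1 * s) \<partial>lborel)"
    using le by (intro nn_integral_mono_AE) (simp add: algebra_simps)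
  also have "\<dots> = (\<integral>\<^sup>+ s. k s \<partial>lborel)"
    using nn_integral_real_affine[of k 1 "- c"] by simp
  finally show ?thesis .
qed

lemma nn_integral_lebesgue_on_borel:
  fixes h :: "real \<Rightarrow> ennreal"
  assumes [measurable]: "h \<in> borel_measurable borel" "S \<in> sets borel"
  shows "(\<integral>\<^sup>+ s. h s \<partial>lebesgue_on S) = (\<integral>\<^sup>+ s. h s * indicator S s \<partial>lborel)"
  by (subst nn_integral_restrict_space) (auto simp: nn_integral_completion)

section \<open>The three estimates for halved powers\<close>

text \<open>
  Each point of an upper half in \<open>{0<..<t}\<close> is moved by \<open>- 1 / 2\<close> to a lower half that still lies in
  \<open>{0<..<t}\<close>. So the zeros fill at least half of the interval, and the levels admitted in the infimum are
  exactly the nonnegative ones.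
\<close>

lemma lower_median_eq_0:
  fixes f :: "real \<Rightarrow> real"
  assumes f: "\<And>s. 0 \<le> f s" "\<And>s. s \<notin> upper_halves \<Longrightarrow> f s = 0"
    and [measurable]: "f \<in> borel_measurable borel" and t: "0 < t"
  shows "lower_median f t = 0"
proof -
  let ?U = "upper_halves \<inter> {0<..<t}" and ?L = "{0<..<t} - upper_halves"
  have "(\<integral>\<^sup>+ s. indicator ?U s \<partial>lborel) \<le> (\<integral>\<^sup>+ s. indicator ?L s \<partial>lborel)"
  proof (rule nn_integral_mono_translate)
    \<comment> \<open>The point \<open>1 / 2\<close> would be moved to 0, which lies outside the open interval.\<close>
    have "(indicator ?U s :: ennreal) \<le> indicator ?L (s - 1 / 2)" if "s \<noteq> 1 / 2" for s
      using upper_halves_ge[of s 0] that by (auto simp: upper_halves_shift split: split_indicator)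
    then show "AE s in lborel. (indicator ?U s :: ennreal) \<le> indicator ?L (s - 1 / 2)"
      by (rule eventually_mono[OF AE_lborel_singleton])
  qed measurable
  then have "emeasure lborel ?U \<le> emeasure lborel ?L"
    by simp
  moreover have fin: "emeasure lborel A < \<infinity>" if "A \<subseteq> {0<..<t}" for A
    using emeasure_mono[OF that, of lborel] t by (auto simp: le_less_trans)
  ultimately have UL: "measure lborel ?U \<le> measure lborel ?L"
    unfolding measure_def by (intro enn2real_mono) auto
  have "measure lborel {0<..<t} = measure lborel ?U + measure lborel ?L"
    using fin[of ?U] fin[of ?L] by (subst measure_Union[symmetric]) (auto intro!: arg_cong[where f = "measure lborel"])
  then have "measure lborel ?U + measure lborel ?L = t"
    using t by simp
  with UL have half: "t / 2 \<le> measure lborel ?L" by simp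
  have "{a. t / 2 \<le> measure lebesgue {s \<in> {0<..<t}. f s \<le> a}} = {0..}"
  proof (intro set_eqI iffI)
    fix a
    assume "a \<in> {a. t / 2 \<le> measure lebesgue {s \<in> {0<..<t}. f s \<le> a}}"
    then have "{s \<in> {0<..<t}. f s \<le> a} \<noteq> {}"
      using t by (auto simp del: Collect_empty_eq)
    then show "a \<in> {0..}" using f(1) by (auto intro: order_trans)
  next
    fix a :: real
    assume a: "a \<in> {0..}"
    have [measurable]: "{s \<in> {0<..<t}. f s \<le> a} \<in> sets borel" by measurable
    have "measure lborel ?L \<le> measure lborel {s \<in> {0<..<t}. f s \<le> a}"
      unfolding measure_def using f(2) a
      by (intro enn2real_mono emeasure_mono fin[unfolded infinity_ennreal_def]) auto
    with half show "a \<in> {a. t / 2 \<le> measure lebesgue {s \<in> {0<..<t}. f s \<le> a}}"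
      by simp
  qed
  then show ?thesis unfolding lower_median_def by simp
qed

lemma nn_integral_powr_atLeast:
  assumes "0 < a" "1 < \<beta>"
  shows "(\<integral>\<^sup>+ t. ennreal (t powr - \<beta>) * indicator {a..} t \<partial>lborel)
    = ennreal (a powr (1 - \<beta>) / (\<beta> - 1))"
proof -
  have "(\<integral>\<^sup>+ t. ennreal (t powr - \<beta>) * indicator {a..} t \<partial>lborel)
      = ennreal (0 - a powr (1 - \<beta>) / (1 - \<beta>))"
  proof (rule nn_integral_FTC_atLeast)
    show "((\<lambda>x. x powr (1 - \<beta>) / (1 - \<beta>)) \<longlongrightarrow> 0) at_top"
      using assms by real_asymp
    show "((\<lambda>x. x powr (1 - \<beta>) / (1 - \<beta>)) has_real_derivative x powr - \<beta>) (at x)"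
      if "a \<le> x" for x
      using that assms by (auto intro!: derivative_eq_intros)
  qed auto
  then show ?thesis by (simp add: minus_divide_right)
qed

text \<open>
  Translation to the left by \<open>1 / 2\<close> increases a decreasing function and carries the upper halves that
  are kept onto lower halves in \<open>{1..}\<close>. Hence the kept part of the integral is at most the erased part,
  and thus at most half of the total.
\<close>

lemma nn_integral_halved_power_le:
  assumes p: "0 < p" and \<alpha>: "1 < \<alpha> * p" "0 < \<alpha>"
  shows "(\<integral>\<^sup>+ t. ennreal (halved_power \<alpha> t powr p) \<partial>lborel) \<le> ennreal (1 / (2 * (\<alpha> * p - 1)))"
proof -
  define g where "g t = ennreal (t powr - (\<alpha> * p)) * indicator {1..} t" for t :: real
  have [measurable]: "g \<in> borel_measurable borel" unfolding g_def by measurable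
  have eq: "ennreal (halved_power \<alpha> t powr p) = g t * indicator upper_halves t" for t
    using p by (auto simp: halved_power_def g_def powr_powr split: split_indicator)
  let ?I = "\<integral>\<^sup>+ t. ennreal (halved_power \<alpha> t powr p) \<partial>lborel"
  have "?I \<le> (\<integral>\<^sup>+ t. g t * indicator (- upper_halves) t \<partial>lborel)"
    unfolding eq
  proof (rule nn_integral_mono_translate[OF _ AE_I2])
    show "g s * indicator upper_halves s \<le> g (s - 1 / 2) * indicator (- upper_halves) (s - 1 / 2)" for s
      using upper_halves_ge[of s 1] \<alpha> p
      by (auto simp: g_def upper_halves_shift intro!: ennreal_leI powr_mono2' split: split_indicator)
  qed measurable
  then have "2 * ?I \<le> ?I + (\<integral>\<^sup>+ t. g t * indicator (- upper_halves) t \<partial>lborel)"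
    by (simp add: mult_2 add_left_mono)
  also have "\<dots> = (\<integral>\<^sup>+ t. g t \<partial>lborel)"
    unfolding eq by (subst nn_integral_add[symmetric]) (auto intro!: nn_integral_cong split: split_indicator)
  also have "\<dots> = ennreal (1 / (\<alpha> * p - 1))"
    unfolding g_def using \<alpha> by (subst nn_integral_powr_atLeast) auto
  finally have twice: "2 * ?I \<le> ennreal (1 / (\<alpha> * p - 1))" .
  then show ?thesis
  proof (cases ?I)
    case (real r)
    have "2 * ?I = ennreal (2 * r)" using real by (simp add: ennreal_mult)
    with twice have "2 * r \<le> 1 / (\<alpha> * p - 1)" using \<alpha> by (simp add: ennreal_le_iff)
    with real \<alpha> show ?thesis by (simp add: ennreal_leI field_simps)
  qed (auto simp: ennreal_mult_top top_unique)
qed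

lemma halved_power_in_nonneg_Lp:
  assumes p: "0 < p" and \<alpha>: "1 < \<alpha> * p" "0 < \<alpha>"
  shows "halved_power \<alpha> \<in> nonneg_Lp p"
proof -
  have meas: "halved_power \<alpha> \<in> borel_measurable (lebesgue_on {0<..})"
    by (intro measurable_restrict_space1 measurable_completion) simp
  have "integrable lborel (\<lambda>x. halved_power \<alpha> x powr p)"
    using nn_integral_halved_power_le[OF assms]
    by (intro integrableI_nonneg) (auto simp: le_less_trans)
  then have "integrable lebesgue (\<lambda>x. \<bar>halved_power \<alpha> x\<bar> powr p)"
    using halved_power_nonneg by (simp add: integrable_completion)
  then have "integrable (lebesgue_on {0<..}) (\<lambda>x. \<bar>halved_power \<alpha> x\<bar> powr p)"
    by (intro integrable_restrict_space[THEN iffD2] integrable_mult_indicator) auto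
  with meas show ?thesis
    unfolding nonneg_Lp_def using halved_power_nonneg by auto
qed

text \<open>
  The same translation bounds the erased part from above: lower halves in \<open>{3 / 2..<t}\<close> are carried
  into upper halves in \<open>{1..<t}\<close>, where the power is larger. So twice the kept integral dominates the
  integral of the full power over \<open>{3 / 2..<t}\<close>. The lower limit \<open>3 / 2\<close> produces the correction
  \<open>(3 / (2 * t)) powr (1 - \<alpha>)\<close>, which disappears as \<open>t\<close> grows.
\<close>

lemma average_halved_power_ge:
  assumes \<alpha>: "0 < \<alpha>" "\<alpha> < 1" and t: "3 / 2 \<le> t"
  shows "t powr - \<alpha> * (1 - (3 / (2 * t)) powr (1 - \<alpha>)) / (2 * (1 - \<alpha>)) \<le> average (halved_power \<alpha>) t"
proof -
  define F where "F = (\<integral>s. halved_power \<alpha> s \<partial>lebesgue_on {0<..<t})"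
  define g where "g s = ennreal (s powr - \<alpha>)" for s :: real
  have [measurable]: "g \<in> borel_measurable borel" unfolding g_def by measurable
  let ?S = "upper_halves \<inter> {1..<t}"
  let ?J = "\<integral>\<^sup>+ s. g s * indicator ?S s \<partial>lborel"
  have J: "ennreal F = ?J"
  proof -
    have N: "(\<integral>\<^sup>+ s. ennreal (halved_power \<alpha> s) \<partial>lebesgue_on {0<..<t}) = ?J"
      by (subst nn_integral_lebesgue_on_borel)
         (auto simp: g_def halved_power_def intro!: nn_integral_cong split: split_indicator)
    have "g s * indicator ?S s \<le> indicator {1..<t} s" for s
      using \<alpha> powr_mono2'[of "- \<alpha>" 1 s] by (auto simp: g_def split: split_indicator)
    then have "?J \<le> (\<integral>\<^sup>+ s. indicator {1..<t} s \<partial>lborel)"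
      by (rule nn_integral_mono)
    also have "\<dots> < top" using t by simp
    finally have "?J < top" .
    moreover have "halved_power \<alpha> \<in> borel_measurable (lebesgue_on {0<..<t})"
      by (intro measurable_restrict_space1 measurable_completion) simp
    then have "F = enn2real ?J"
      unfolding F_def N[symmetric] using halved_power_nonneg
      by (intro integral_eq_nn_integral) auto
    ultimately show ?thesis by simp
  qed
  have F0: "0 \<le> F" unfolding F_def using halved_power_nonneg by (intro integral_nonneg_AE) auto
  have up: "(\<integral>\<^sup>+ s. g s * indicator (upper_halves \<inter> {3/2..<t}) s \<partial>lborel) \<le> ?J"
    by (intro nn_integral_mono) (auto split: split_indicator)
  have lo: "(\<integral>\<^sup>+ s. g s * indicator ({3/2..<t} - upper_halves) s \<partial>lborel) \<le> ?J"
  proof (rule nn_integral_mono_translate[OF _ AE_I2])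
    show "g s * indicator ({3/2..<t} - upper_halves) s \<le> g (s - 1 / 2) * indicator ?S (s - 1 / 2)" for s
      using \<alpha> by (auto simp: g_def upper_halves_shift intro!: ennreal_leI powr_mono2' split: split_indicator)
  qed measurable
  have "ennreal ((t powr (1 - \<alpha>) - (3/2) powr (1 - \<alpha>)) / (1 - \<alpha>))
      = (\<integral>\<^sup>+ s. ennreal (s powr - \<alpha>) * indicator {3/2..t} s \<partial>lborel)"
    unfolding diff_divide_distrib
    using t \<alpha>
    by (intro nn_integral_FTC_Icc[symmetric])
       (auto intro!: derivative_eq_intros simp: has_real_derivative_iff_has_vector_derivative[symmetric])
  also have "\<dots> = (\<integral>\<^sup>+ s. g s * indicator {3/2..<t} s \<partial>lborel)"
    unfolding g_def
    by (intro nn_integral_cong_AE eventually_mono[OF AE_lborel_singleton[of t]])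
       (auto split: split_indicator)
  also have "\<dots> = (\<integral>\<^sup>+ s. g s * indicator (upper_halves \<inter> {3/2..<t}) s \<partial>lborel)
      + (\<integral>\<^sup>+ s. g s * indicator ({3/2..<t} - upper_halves) s \<partial>lborel)"
    by (subst nn_integral_add[symmetric]) (auto intro!: nn_integral_cong split: split_indicator)
  also have "\<dots> \<le> ?J + ?J"
    by (rule add_mono[OF up lo])
  finally have "(t powr (1 - \<alpha>) - (3/2) powr (1 - \<alpha>)) / (1 - \<alpha>) \<le> 2 * F"
    unfolding J[symmetric] using F0 by (simp add: ennreal_plus[symmetric] del: ennreal_plus)
  then have "t powr (1 - \<alpha>) * (1 - (3 / (2 * t)) powr (1 - \<alpha>)) / (1 - \<alpha>) \<le> 2 * F"
    using t by (simp add: powr_divide right_diff_distrib powr_mult)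
  then have "t powr (1 - \<alpha>) * (1 - (3 / (2 * t)) powr (1 - \<alpha>)) / (1 - \<alpha>) / (2 * t) \<le> 2 * F / (2 * t)"
    using t by (intro divide_right_mono) auto
  moreover have "t powr - \<alpha> = t powr (1 - \<alpha>) / t"
    using t by (simp add: powr_diff powr_minus field_simps)
  ultimately show ?thesis
    unfolding average_def F_def[symmetric] by (simp add: mult_ac)
qed

section \<open>Lower bounds for the constant\<close>

text \<open>
  On \<open>{T..}\<close> the average is at least \<open>c * t powr - \<alpha>\<close> with one constant \<open>c\<close>, the value of the correction
  at \<open>T\<close>. Both sides of the inequality then reduce to tails of the same power
  \<open>t powr - (\<alpha> * p)\<close>; the factor \<open>1 / (\<alpha> * p - 1)\<close>, which blows up as \<open>\<alpha>\<close> approaches \<open>1 / p\<close>, appears on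
  both sides and cancels.
\<close>

lemma constant_ge_at_exponent:
  fixes p C :: real
  assumes p: "1 < p"
    and ineq: "\<And>f. f \<in> nonneg_Lp p \<Longrightarrow>
      enn2ereal (\<integral>\<^sup>+ t. ennreal (\<bar>lower_median f t - average f t\<bar> powr p) \<partial>lebesgue_on {0<..})
        \<le> ereal C * enn2ereal (\<integral>\<^sup>+ t. ennreal (f t powr p) \<partial>lebesgue_on {0<..})"
    and \<alpha>: "1 < \<alpha> * p" "\<alpha> < 1" and T: "3 / 2 < T"
  shows "2 * T powr (1 - \<alpha> * p) * ((1 - (3 / (2 * T)) powr (1 - \<alpha>)) / (2 * (1 - \<alpha>))) powr p \<le> C"
proof -
  have \<alpha>0: "0 < \<alpha>" using \<alpha> p by (smt (verit) mult_nonpos_nonneg)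
  define f where "f = halved_power \<alpha>"
  define c where "c = (1 - (3 / (2 * T)) powr (1 - \<alpha>)) / (2 * (1 - \<alpha>))"
  define b where "b = \<alpha> * p - 1"
  have b: "0 < b" using \<alpha> by (simp add: b_def)
  have c: "0 < c" using \<alpha> T powr_less_mono2[of "1 - \<alpha>" "3 / (2 * T)" 1] by (simp add: c_def)
  let ?L = "\<integral>\<^sup>+ t. ennreal (\<bar>lower_median f t - average f t\<bar> powr p) \<partial>lebesgue_on {0<..}"
  let ?R = "\<integral>\<^sup>+ t. ennreal (f t powr p) \<partial>lebesgue_on {0<..}"
  have avg: "c * t powr - \<alpha> \<le> \<bar>lower_median f t - average f t\<bar>" if "T \<le> t" for t
  proof -
    have "lower_median f t = 0"
      using that T unfolding f_def
      by (intro lower_median_eq_0 halved_power_nonneg) (auto simp: halved_power_def)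
    moreover have "(3 / (2 * t)) powr (1 - \<alpha>) \<le> (3 / (2 * T)) powr (1 - \<alpha>)"
      using that T \<alpha> by (intro powr_mono2) (auto simp: field_simps)
    then have "c * t powr - \<alpha> \<le> t powr - \<alpha> * (1 - (3 / (2 * t)) powr (1 - \<alpha>)) / (2 * (1 - \<alpha>))"
      using \<alpha> unfolding c_def
      by (simp add: divide_right_mono mult_left_mono mult.commute)
    moreover have "\<dots> \<le> average f t"
      unfolding f_def using average_halved_power_ge[of \<alpha> t] that T \<alpha> \<alpha>0 by simp
    ultimately show ?thesis by simp
  qed
  have "ennreal (c powr p * (T powr - b / b))
      = (\<integral>\<^sup>+ t. ennreal (c powr p) * (ennreal (t powr - (\<alpha> * p)) * indicator {T..} t) \<partial>lborel)"
    using nn_integral_powr_atLeast[of T "\<alpha> * p"] T \<alpha> b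
    by (subst nn_integral_cmult) (auto simp: b_def ennreal_mult[symmetric])
  also have "\<dots> = (\<integral>\<^sup>+ t. ennreal (c powr p) * (ennreal (t powr - (\<alpha> * p)) * indicator {T..} t) \<partial>lebesgue_on {0<..})"
    using T by (subst nn_integral_lebesgue_on_borel) (auto intro!: nn_integral_cong split: split_indicator)
  also have "\<dots> \<le> ?L"
  proof (intro nn_integral_mono)
    fix t
    have "c powr p * t powr - (\<alpha> * p) \<le> \<bar>lower_median f t - average f t\<bar> powr p" if "T \<le> t"
    proof -
      have "c powr p * t powr - (\<alpha> * p) = (c * t powr - \<alpha>) powr p"
        using c by (simp add: powr_mult powr_powr)
      also have "\<dots> \<le> \<bar>lower_median f t - average f t\<bar> powr p"
        using avg[OF that] c p by (intro powr_mono2) auto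
      finally show ?thesis .
    qed
    then show "ennreal (c powr p) * (ennreal (t powr - (\<alpha> * p)) * indicator {T..} t)
        \<le> ennreal (\<bar>lower_median f t - average f t\<bar> powr p)"
      by (auto simp: ennreal_mult[symmetric] ennreal_leI split: split_indicator)
  qed
  finally have L: "ereal (c powr p * (T powr - b / b)) \<le> enn2ereal ?L"
    using b by (simp add: less_eq_ennreal.rep_eq)
  have "?R \<le> (\<integral>\<^sup>+ t. ennreal (f t powr p) \<partial>lborel)"
    unfolding f_def
    by (subst nn_integral_lebesgue_on_borel) (auto intro!: nn_integral_mono split: split_indicator)
  also have "\<dots> \<le> ennreal (1 / (2 * b))"
    unfolding f_def b_def using p \<alpha> \<alpha>0 by (intro nn_integral_halved_power_le) auto
  finally have R: "enn2ereal ?R \<le> ereal (1 / (2 * b))"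
    using b by (simp add: less_eq_ennreal.rep_eq)
  have LR: "ereal (c powr p * (T powr - b / b)) \<le> ereal C * enn2ereal ?R"
    using L ineq[of f] halved_power_in_nonneg_Lp[of p \<alpha>] p \<alpha> \<alpha>0 unfolding f_def
    by (auto intro: order_trans)
  obtain r where r: "enn2ereal ?R = ereal r" "0 \<le> r" "r \<le> 1 / (2 * b)"
    using R enn2ereal_nonneg[of ?R] by (cases "enn2ereal ?R") auto
  have main: "c powr p * (T powr - b / b) \<le> C * r"
    using LR r by simp
  have "0 < c powr p * (T powr - b / b)" using c T b by simp
  \<comment> \<open>The bound on \<open>r\<close> is an upper one, so it can replace \<open>r\<close> only once \<open>C\<close> is known to be positive.\<close>
  with main r have "0 < C" by (smt (verit) mult_nonpos_nonneg)
  with main r have "c powr p * (T powr - b / b) \<le> C * (1 / (2 * b))"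
    by (smt (verit) mult_left_mono)
  with b have "2 * T powr - b * c powr p \<le> C" by (simp add: field_simps)
  then show ?thesis by (simp add: b_def c_def)
qed

theorem theorem2:
  fixes p C :: real
  assumes "p > 1"
    and "\<And>f. f \<in> nonneg_Lp p \<Longrightarrow>
      enn2ereal (\<integral>\<^sup>+ t. ennreal (\<bar>lower_median f t - average f t\<bar> powr p) \<partial>lebesgue_on {0<..})
        \<le> ereal C * enn2ereal (\<integral>\<^sup>+ t. ennreal (f t powr p) \<partial>lebesgue_on {0<..})"
  shows "C \<ge> 2 powr (1 - p) * (p / (p - 1)) powr p"
proof -
  note p = \<open>p > 1\<close>
  \<comment> \<open>With \<open>T\<close> fixed, the exponent may reach \<open>1 / p\<close>; there the factor \<open>T powr (1 - \<alpha> * p)\<close> becomes 1,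
      and only then is it possible to let \<open>T\<close> grow.\<close>
  let ?B = "\<lambda>\<alpha> T. 2 * T powr (1 - \<alpha> * p) * ((1 - (3 / (2 * T)) powr (1 - \<alpha>)) / (2 * (1 - \<alpha>))) powr p"
  have T_bound: "?B (1 / p) T \<le> C" if T: "3 / 2 < T" for T
  proof (rule tendsto_upperbound)
    have "(3 / (2 * T)) powr (1 - 1 / p) < 1"
      using powr_less_mono2[of "1 - 1 / p" "3 / (2 * T)" 1] T p by simp
    then show "((\<lambda>\<alpha>. ?B \<alpha> T) \<longlongrightarrow> ?B (1 / p) T) (at_right (1 / p))"
      using T p by (intro tendsto_mult tendsto_powr tendsto_divide tendsto_diff tendsto_const tendsto_ident_at)
        (auto simp: field_simps)
    have "\<forall>\<^sub>F \<alpha> in at_right (1 / p). \<alpha> \<in> {1 / p <..< 1}"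
      using p by (intro eventually_at_right_real) auto
    then show "\<forall>\<^sub>F \<alpha> in at_right (1 / p). ?B \<alpha> T \<le> C"
    proof (rule eventually_mono)
      fix \<alpha> assume "\<alpha> \<in> {1 / p<..<1}"
      then have "1 < \<alpha> * p" "\<alpha> < 1" using p by (auto simp: field_simps)
      with assms T show "?B \<alpha> T \<le> C" by (intro constant_ge_at_exponent)
    qed
  qed simp
  have "2 * (1 / (2 * (1 - 1 / p))) powr p \<le> C"
  proof (rule tendsto_upperbound)
    have "((\<lambda>T. (3 / (2 * T)) powr (1 - 1 / p)) \<longlongrightarrow> 0) at_top"
      using p by real_asymp
    then have "((\<lambda>T. 2 * ((1 - (3 / (2 * T)) powr (1 - 1 / p)) / (2 * (1 - 1 / p))) powr p)
        \<longlongrightarrow> 2 * ((1 - 0) / (2 * (1 - 1 / p))) powr p) at_top"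
      using p by (intro tendsto_mult tendsto_powr tendsto_divide tendsto_diff tendsto_const)
        (auto simp: field_simps)
    then show "((\<lambda>T. 2 * ((1 - (3 / (2 * T)) powr (1 - 1 / p)) / (2 * (1 - 1 / p))) powr p)
        \<longlongrightarrow> 2 * (1 / (2 * (1 - 1 / p))) powr p) at_top" by simp
    show "\<forall>\<^sub>F T in at_top. 2 * ((1 - (3 / (2 * T)) powr (1 - 1 / p)) / (2 * (1 - 1 / p))) powr p \<le> C"
      using eventually_gt_at_top[of "3 / 2"]
      by eventually_elim (use T_bound p in force)
  qed simp
  moreover have "1 / (2 * (1 - 1 / p)) = (p / (p - 1)) / 2"
    using p by (simp add: field_simps)
  moreover have "2 * (x / 2) powr p = 2 powr (1 - p) * x powr p" if "0 \<le> x" for x :: real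
    using that by (simp add: powr_divide powr_diff)
  from this[of "p / (p - 1)"] have "2 * ((p / (p - 1)) / 2) powr p = 2 powr (1 - p) * (p / (p - 1)) powr p"
    using p by simp
  ultimately show ?thesis
    by (simp only:)
qed

end
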